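(* Let $C = (C_2 \xrightarrow{\partial} C_1 \xrightarrow{\partial} C_0)$ be a chain complex of $\mathbb{F}_2$-vector spaces such that each degree is a direct sum of $\mathbb{F}_2$-vector spaces $C_i = C^2_i \oplus C^1_i \oplus C^0_i$, and such that the differential $\partial : C_i \to C_{i-1}$ is lower-triangular with respect to this decomposition, with matrix elements denoted $$\partial = \begin{pmatrix} \partial^2 & & \\ g_2 & \partial^1 & \\ p & g_1 & \partial^0 \end{pmatrix},$$ so that $\partial^s : C^s_i \to C^s_{i-1}$ for $s=2,1,0$, $g_2 : C^2_i \to C^1_{i-1}$, $g_1: C^1_i \to C^0_{i-1}$ and $p : C^2_i \to C^0_{i-1}$. Then the following are chain complexes over $\mathbb{F}_2$: $$C^s = (C^s_2 \xrightarrow{\partial^s} C^s_1 \xrightarrow{\partial^s} C^s_0), \quad s = 2,1,0,$$ $$C^{\mathbf g} = \big(H_2(\partial^2) \xrightarrow{[g_2]} H_1(\partial^1) \xrightarrow{[g_1]} H_0(\partial^0)\big),$$ where $H_i(\partial^s)$ denotes the $i$-th homology of $C^s$ and $[g_2],[g_1]$ are the maps induced by $g_2,g_1$ on homology classes, $[g_2][\ell]=[g_2\ell]$ and $[g_1][\ell]=[g_1\ell]$ (in particular these are well defined). Moreover, if $H_1(\partial^0) = H_1(\partial^2) = 0$, then $H_1(\partial^{\mathbf g})$ (the degree-1 homology $\ker[g_1]/\operatorname{im}[g_2]$ of $C^{\mathbf g}$) is isomorphic to $H_1(\partial)$ (the degree-1 homology of $C$) via the map $$\llbracket \ell^1_1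 \rrbracket \mapsto \left[\begin{pmatrix} 0 \\ \ell^1_1 \\ \ell^0_1 \end{pmatrix}\right],$$ where $\ell^1_1 \in C^1_1$ is a representative of a class $[\ell^1_1] \in H_1(\partial^1)$, which in turn is a representative of the class $\llbracket \ell^1_1\rrbracket \in H_1(\partial^{\mathbf g})$, where $\ell^0_1 \in C^0_1$ is any element such that $g_1 \ell^1_1 + \partial^0 \ell^0_1 = 0$ (the existence of such an element is guaranteed), and the right-hand side is the homology class of the given element of $C_1 = C^2_1\oplus C^1_1 \oplus C^0_1$.
   Context: A chain complex over $\mathbb{F}_2$ is a sequence of $\mathbb{F}_2$-vector spaces and linear maps $\partial$ with $\partial\partial = 0$; degrees outside those displayed are $0$. Its $i$-th homology is $\ker \partial_i / \operatorname{im}\partial_{i+1}$; $H_i(\partial)$ denotes the homology of the complex with differential $\partial$. $[\ell]$ denotes the homology class of a cycle $\ell$ in $C$ or in a $C^s$; $\llbracket \ell \rrbracket$ denotes the class in $H_1(\partial^{\mathbf g})$ of $[\ell]\in \ker [g_1]\subseteq H_1(\partial^1)$. *)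

theory Defs
  imports "HOL-Number_Theory.Residues" "HOL-Algebra.Module"
begin

abbreviation F2 :: "int ring" where
  "F2 \<equiv> residue_ring 2"

lemma field_F2: "field F2"
  using residues_prime.is_field[of 2] by (simp add: residues_prime_def)

definition module_hom ::
    "('r, 'k) ring_scheme \<Rightarrow> ('r, 'a) module \<Rightarrow> ('r, 'b) module \<Rightarrow> ('a \<Rightarrow> 'b) set" where
  "module_hom R M N =
     {h. h \<in> carrier M \<rightarrow> carrier N \<and>
         (\<forall>x\<in>carrier M. \<forall>y\<in>carrier M. h (x \<oplus>\<^bsub>M\<^esub> y) = h x \<oplus>\<^bsub>N\<^esub> h y) \<and>
         (\<forall>r\<in>carrier R. \<forall>x\<in>carrier M. h (r \<odot>\<^bsub>M\<^esub> x) = r \<odot>\<^bsub>N\<^esub> h x)}"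

definition module_iso ::
    "('r, 'k) ring_scheme \<Rightarrow> ('r, 'a) module \<Rightarrow> ('r, 'b) module \<Rightarrow> ('a \<Rightarrow> 'b) set" where
  "module_iso R M N = {h \<in> module_hom R M N. bij_betw h (carrier M) (carrier N)}"

text \<open>Module records inherit the fields \<open>mult\<close> and \<open>one\<close> from ring records; the module
  axioms do not mention them, so they are left undefined below.\<close>

definition direct_sum ::
    "('r, 'a) module \<Rightarrow> ('r, 'b) module \<Rightarrow> ('r, 'a \<times> 'b) module" (infixr "\<oplus>\<^sub>M" 65) where
  "M \<oplus>\<^sub>M N =
     \<lparr>carrier = carrier M \<times> carrier N, monoid.mult = undefined, one = undefined,
      zero = (\<zero>\<^bsub>M\<^esub>, \<zero>\<^bsub>N\<^esub>),
      add = (\<lambda>(x, y) (x', y'). (x \<oplus>\<^bsub>M\<^esub> x', y \<oplus>\<^bsub>N\<^esub> y')),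
      smult = (\<lambda>r (x, y). (r \<odot>\<^bsub>M\<^esub> x, r \<odot>\<^bsub>N\<^esub> y))\<rparr>"

definition quotient_module :: "('r, 'a) module \<Rightarrow> 'a set \<Rightarrow> ('r, 'a set) module" where
  "quotient_module M B =
     \<lparr>carrier = a_rcosets\<^bsub>M\<^esub> B, monoid.mult = undefined, one = undefined,
      zero = B,
      add = set_add M,
      smult = (\<lambda>r X. \<Union>x\<in>X. B +>\<^bsub>M\<^esub> (r \<odot>\<^bsub>M\<^esub> x))\<rparr>"

text \<open>Complexes concentrated in degrees 2, 1, 0; \<open>bd2\<close> and \<open>bd1\<close> are the differentials
  starting in degrees 2 and 1.\<close>

record ('r, 'a, 'b, 'c) complex3 =
  deg2 :: "('r, 'a) module"
  deg1 :: "('r, 'b) module"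
  deg0 :: "('r, 'c) module"
  bd2 :: "'a \<Rightarrow> 'b"
  bd1 :: "'b \<Rightarrow> 'c"

definition chain_complex3 ::
    "('r, 'k) ring_scheme \<Rightarrow> ('r, 'a, 'b, 'c) complex3 \<Rightarrow> bool" where
  "chain_complex3 R C \<longleftrightarrow>
     module R (deg2 C) \<and> module R (deg1 C) \<and> module R (deg0 C) \<and>
     bd2 C \<in> module_hom R (deg2 C) (deg1 C) \<and>
     bd1 C \<in> module_hom R (deg1 C) (deg0 C) \<and>
     (\<forall>x\<in>carrier (deg2 C). bd1 C (bd2 C x) = \<zero>\<^bsub>deg0 C\<^esub>)"

definition cycles2 :: "('r, 'a, 'b, 'c) complex3 \<Rightarrow> 'a set" where
  "cycles2 C = a_kernel (deg2 C) (deg1 C) (bd2 C)"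

definition cycles1 :: "('r, 'a, 'b, 'c) complex3 \<Rightarrow> 'b set" where
  "cycles1 C = a_kernel (deg1 C) (deg0 C) (bd1 C)"

definition cycles0 :: "('r, 'a, 'b, 'c) complex3 \<Rightarrow> 'c set" where
  "cycles0 C = carrier (deg0 C)"

definition boundaries2 :: "('r, 'a, 'b, 'c) complex3 \<Rightarrow> 'a set" where
  "boundaries2 C = {\<zero>\<^bsub>deg2 C\<^esub>}"

definition boundaries1 :: "('r, 'a, 'b, 'c) complex3 \<Rightarrow> 'b set" where
  "boundaries1 C = bd2 C ` carrier (deg2 C)"

definition boundaries0 :: "('r, 'a, 'b, 'c) complex3 \<Rightarrow> 'c set" where
  "boundaries0 C = bd1 C ` carrier (deg1 C)"

definition homology2 :: "('r, 'a, 'b, 'c) complex3 \<Rightarrow> ('r, 'a set) module" where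
  "homology2 C = quotient_module ((deg2 C)\<lparr>carrier := cycles2 C\<rparr>) (boundaries2 C)"

definition homology1 :: "('r, 'a, 'b, 'c) complex3 \<Rightarrow> ('r, 'b set) module" where
  "homology1 C = quotient_module ((deg1 C)\<lparr>carrier := cycles1 C\<rparr>) (boundaries1 C)"

definition homology0 :: "('r, 'a, 'b, 'c) complex3 \<Rightarrow> ('r, 'c set) module" where
  "homology0 C = quotient_module ((deg0 C)\<lparr>carrier := cycles0 C\<rparr>) (boundaries0 C)"

definition hclass2 :: "('r, 'a, 'b, 'c) complex3 \<Rightarrow> 'a \<Rightarrow> 'a set" where
  "hclass2 C l = boundaries2 C +>\<^bsub>deg2 C\<^esub> l"

definition hclass1 :: "('r, 'a, 'b, 'c) complex3 \<Rightarrow> 'b \<Rightarrow> 'b set" where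
  "hclass1 C l = boundaries1 C +>\<^bsub>deg1 C\<^esub> l"

definition hclass0 :: "('r, 'a, 'b, 'c) complex3 \<Rightarrow> 'c \<Rightarrow> 'c set" where
  "hclass0 C l = boundaries0 C +>\<^bsub>deg0 C\<^esub> l"

text \<open>The map on classes sending \<open>[x]\<close> to \<open>cl (g x)\<close>. It is meaningful only if \<open>cl (g x)\<close>
  does not depend on the representative \<open>x\<close> of the class \<open>X\<close>; otherwise \<^const>\<open>the_elem\<close>
  returns an unspecified value.\<close>

definition induced_map :: "('b \<Rightarrow> 'b set) \<Rightarrow> ('a \<Rightarrow> 'b) \<Rightarrow> 'a set \<Rightarrow> 'b set" where
  "induced_map cl g X = the_elem ((\<lambda>x. cl (g x)) ` X)"

text \<open>The map \<open>D\<close> from \<open>A2 \<oplus> A1 \<oplus> A0\<close> to \<open>B2 \<oplus> B1 \<oplus> B0\<close> is lower-triangular, with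
  matrix rows \<open>(d2, 0, 0)\<close>, \<open>(g2, d1, 0)\<close>, \<open>(p, g1, d0)\<close> and linear matrix elements.\<close>

definition lower_triangular ::
    "('r, 'k) ring_scheme \<Rightarrow>
     ('r, 'a2) module \<times> ('r, 'a1) module \<times> ('r, 'a0) module \<Rightarrow>
     ('r, 'b2) module \<times> ('r, 'b1) module \<times> ('r, 'b0) module \<Rightarrow>
     ('a2 \<times> 'a1 \<times> 'a0 \<Rightarrow> 'b2 \<times> 'b1 \<times> 'b0) \<Rightarrow>
     ('a2 \<Rightarrow> 'b2) \<Rightarrow>
     ('a2 \<Rightarrow> 'b1) \<Rightarrow> ('a1 \<Rightarrow> 'b1) \<Rightarrow>
     ('a2 \<Rightarrow> 'b0) \<Rightarrow> ('a1 \<Rightarrow> 'b0) \<Rightarrow> ('a0 \<Rightarrow> 'b0) \<Rightarrow> bool" where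
  "lower_triangular R = (\<lambda>(A2, A1, A0) (B2, B1, B0) D d2 g2 d1 p g1 d0.
     d2 \<in> module_hom R A2 B2 \<and>
     g2 \<in> module_hom R A2 B1 \<and> d1 \<in> module_hom R A1 B1 \<and>
     p \<in> module_hom R A2 B0 \<and> g1 \<in> module_hom R A1 B0 \<and> d0 \<in> module_hom R A0 B0 \<and>
     (\<forall>x2\<in>carrier A2. \<forall>x1\<in>carrier A1. \<forall>x0\<in>carrier A0.
        D (x2, x1, x0) =
          (d2 x2,
           g2 x2 \<oplus>\<^bsub>B1\<^esub> d1 x1,
           p x2 \<oplus>\<^bsub>B0\<^esub> g1 x1 \<oplus>\<^bsub>B0\<^esub> d0 x0)))"

text \<open>The complex \<open>H\<^sub>2(K2) \<rightarrow> H\<^sub>1(K1) \<rightarrow> H\<^sub>0(K0)\<close> with the differentials induced by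
  \<open>g2\<close> and \<open>g1\<close>.\<close>

definition homology_complex ::
    "('r, 'a2, 'b2, 'c2) complex3 \<Rightarrow> ('r, 'a1, 'b1, 'c1) complex3 \<Rightarrow>
     ('r, 'a0, 'b0, 'c0) complex3 \<Rightarrow> ('a2 \<Rightarrow> 'b1) \<Rightarrow> ('b1 \<Rightarrow> 'c0) \<Rightarrow>
     ('r, 'a2 set, 'b1 set, 'c0 set) complex3" where
  "homology_complex K2 K1 K0 g2 g1 =
     \<lparr>deg2 = homology2 K2, deg1 = homology1 K1, deg0 = homology0 K0,
      bd2 = induced_map (hclass1 K1) g2, bd1 = induced_map (hclass0 K0) g1\<rparr>"

end

theory Submission
  imports Defs
begin

text \<open>The entries of \<open>\<partial>\<partial> = 0\<close> say that \<open>\<partial>\<^sup>s\<partial>\<^sup>s = 0\<close>, that \<open>g\<^sub>2\<close> and \<open>g\<^sub>1\<close> commute with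
  the differentials up to sign, and that \<open>p\<close> is a null-homotopy of \<open>g\<^sub>1 g\<^sub>2\<close> on cycles of \<open>\<partial>\<^sup>2\<close>; this gives the complexes.
  For the isomorphism consider the degree-1 cycles \<open>(0, y, z)\<close> of \<open>C\<close>. They map to both
  homologies, by \<open>y\<close> alone and by inclusion, with the same kernel because \<open>H\<^sub>1(\<partial>\<^sup>0) = 0\<close>. The first map is
  always surjective; the second is because, as \<open>H\<^sub>1(\<partial>\<^sup>2) = 0\<close>, every cycle becomes of this form after
  subtracting a boundary. Hence the two quotients agree.\<close>

section \<open>Module homomorphisms\<close>

lemma module_homI:
  assumes "\<And>x. x \<in> carrier M \<Longrightarrow> h x \<in> carrier N"
    and "\<And>x y. \<lbrakk>x \<in> carrier M; y \<in> carrier M\<rbrakk> \<Longrightarrow> h (x \<oplus>\<^bsub>M\<^esub> y) = h x \<oplus>\<^bsub>N\<^esub> h y"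
    and "\<And>r x. \<lbrakk>r \<in> carrier R; x \<in> carrier M\<rbrakk> \<Longrightarrow> h (r \<odot>\<^bsub>M\<^esub> x) = r \<odot>\<^bsub>N\<^esub> h x"
  shows "h \<in> module_hom R M N"
  using assms by (auto simp: module_hom_def)

lemma module_hom_closed: "\<lbrakk>h \<in> module_hom R M N; x \<in> carrier M\<rbrakk> \<Longrightarrow> h x \<in> carrier N"
  by (auto simp: module_hom_def)

lemma module_hom_add:
  "\<lbrakk>h \<in> module_hom R M N; x \<in> carrier M; y \<in> carrier M\<rbrakk> \<Longrightarrow> h (x \<oplus>\<^bsub>M\<^esub> y) = h x \<oplus>\<^bsub>N\<^esub> h y"
  by (auto simp: module_hom_def)

lemma module_hom_smult:
  "\<lbrakk>h \<in> module_hom R M N; r \<in> carrier R; x \<in> carrier M\<rbrakk> \<Longrightarrow> h (r \<odot>\<^bsub>M\<^esub> x) = r \<odot>\<^bsub>N\<^esub> h x"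
  by (auto simp: module_hom_def)

lemma module_hom_zero:
  assumes "module R M" "module R N" "h \<in> module_hom R M N"
  shows "h \<zero>\<^bsub>M\<^esub> = \<zero>\<^bsub>N\<^esub>"
proof -
  interpret M: module R M by fact
  interpret N: module R N by fact
  have c: "h \<zero>\<^bsub>M\<^esub> \<in> carrier N"
    using assms(3) by (simp add: module_hom_closed)
  have "h \<zero>\<^bsub>M\<^esub> \<oplus>\<^bsub>N\<^esub> h \<zero>\<^bsub>M\<^esub> = h \<zero>\<^bsub>M\<^esub>"
    using module_hom_add[OF assms(3), of "\<zero>\<^bsub>M\<^esub>" "\<zero>\<^bsub>M\<^esub>"] by simp
  with c show ?thesis by (metis N.add.r_cancel_one)
qed

lemma module_hom_minus:
  assumes "module R M" "module R N" "h \<in> module_hom R M N" "x \<in> carrier M"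
  shows "h (\<ominus>\<^bsub>M\<^esub> x) = \<ominus>\<^bsub>N\<^esub> h x"
proof -
  interpret M: module R M by fact
  interpret N: module R N by fact
  have "h (\<ominus>\<^bsub>M\<^esub> x) \<oplus>\<^bsub>N\<^esub> h x = \<zero>\<^bsub>N\<^esub>"
    using module_hom_add[OF assms(3), of "\<ominus>\<^bsub>M\<^esub> x" x] assms(4) module_hom_zero[OF assms(1-3)]
    by (simp add: M.l_neg)
  then show ?thesis
    by (rule N.minus_equality[symmetric]) (simp_all add: assms(4) module_hom_closed[OF assms(3)])
qed

lemma module_hom_diff:
  assumes "module R M" "module R N" "h \<in> module_hom R M N" "x \<in> carrier M" "y \<in> carrier M"
  shows "h (x \<ominus>\<^bsub>M\<^esub> y) = h x \<ominus>\<^bsub>N\<^esub> h y"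
proof -
  interpret M: module R M by fact
  show ?thesis
    using assms(4,5) module_hom_add[OF assms(3)] module_hom_minus[OF assms(1-3)]
    by (simp add: a_minus_def)
qed

lemma module_hom_comp:
  "\<lbrakk>f \<in> module_hom R L M; h \<in> module_hom R M N\<rbrakk> \<Longrightarrow> (\<lambda>x. h (f x)) \<in> module_hom R L N"
  by (auto simp: module_hom_def Pi_iff)

text \<open>Submodules are represented by updating the carrier of the ambient record and keeping its
  operations, so cutting down source and target only affects the membership conditions.\<close>

lemma module_hom_restrict:
  assumes "h \<in> module_hom R M N" "A \<subseteq> carrier M" "\<And>x. x \<in> A \<Longrightarrow> h x \<in> B"
  shows "h \<in> module_hom R (M\<lparr>carrier := A\<rparr>) (N\<lparr>carrier := B\<rparr>)"
  using assms by (auto simp: module_hom_def subset_iff)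

section \<open>Kernels, images and submodules\<close>

lemma mem_a_kernel: "x \<in> a_kernel M N h \<longleftrightarrow> x \<in> carrier M \<and> h x = \<zero>\<^bsub>N\<^esub>"
  by (auto simp: a_kernel_def')

lemma submodule_kernel:
  assumes "module R M" "module R N" "h \<in> module_hom R M N"
  shows "submodule (a_kernel M N h) R M"
proof -
  interpret M: module R M by fact
  interpret N: module R N by fact
  show ?thesis
    by (rule M.submoduleI)
      (auto simp: mem_a_kernel module_hom_zero[OF assms] module_hom_minus[OF assms]
        module_hom_add[OF assms(3)] module_hom_smult[OF assms(3)])
qed

lemma submodule_image:
  assumes "module R M" "module R N" "h \<in> module_hom R M N"
  shows "submodule (h ` carrier M) R N"
proof -
  interpret M: module R M by fact
  interpret N: module R N by fact
  note hom = module_hom_zero[OF assms] module_hom_minus[OF assms]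
    module_hom_add[OF assms(3)] module_hom_smult[OF assms(3)]
  show ?thesis
  proof (rule N.submoduleI)
    show "h ` carrier M \<subseteq> carrier N"
      using assms(3) by (auto simp: module_hom_closed)
    show "\<zero>\<^bsub>N\<^esub> \<in> h ` carrier M"
      by (metis hom(1) M.zero_closed imageI)
    show "\<ominus>\<^bsub>N\<^esub> a \<in> h ` carrier M" if "a \<in> h ` carrier M" for a
      using that by (auto simp: hom(2)[symmetric])
    show "a \<oplus>\<^bsub>N\<^esub> b \<in> h ` carrier M" if "a \<in> h ` carrier M" "b \<in> h ` carrier M" for a b
      using that by (auto simp: hom(3)[symmetric])
    show "r \<odot>\<^bsub>N\<^esub> a \<in> h ` carrier M" if "r \<in> carrier R" "a \<in> h ` carrier M" for r a
      using that by (auto simp: hom(4)[symmetric])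
  qed
qed

lemma submodule_zero:
  assumes "module R M"
  shows "submodule {\<zero>\<^bsub>M\<^esub>} R M"
proof -
  interpret M: module R M by fact
  show ?thesis by (rule M.submoduleI) auto
qed

lemma submodule_subset:
  assumes "submodule H R M"
  shows "H \<subseteq> carrier M"
  using subgroup.subset[OF submodule.axioms(1)[OF assms]] by simp

text \<open>Homology is a quotient of the cycles, so the boundaries must be a submodule of the
  record whose carrier is the set of cycles.\<close>

lemma submodule_restrict:
  assumes "module R M" "submodule A R M" "submodule B R M" "B \<subseteq> A"
  shows "submodule B R (M\<lparr>carrier := A\<rparr>)"
  by (rule module.module_incl_imp_submodule)
    (use assms submodule.submodule_is_module in auto)

text \<open>Negating the witness exchanges the two conditions. The left side is the form in which
  \<open>l0\<close> is prescribed in the theorem; the right side is membership in the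
  boundaries.\<close>

lemma add_hom_eq_zero_iff_mem_image:
  assumes "module R M" "module R N" "h \<in> module_hom R M N" "y \<in> carrier N"
  shows "(\<exists>x\<in>carrier M. y \<oplus>\<^bsub>N\<^esub> h x = \<zero>\<^bsub>N\<^esub>) \<longleftrightarrow> y \<in> h ` carrier M"
proof -
  interpret M: module R M by fact
  interpret N: module R N by fact
  note m = module_hom_minus[OF assms(1-3)] and c = module_hom_closed[OF assms(3)]
  show ?thesis
  proof
    assume "\<exists>x\<in>carrier M. y \<oplus>\<^bsub>N\<^esub> h x = \<zero>\<^bsub>N\<^esub>"
    then obtain x where "x \<in> carrier M" "y \<oplus>\<^bsub>N\<^esub> h x = \<zero>\<^bsub>N\<^esub>" by blast
    then have "y = h (\<ominus>\<^bsub>M\<^esub> x)"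
      using m c assms(4) N.minus_equality[of y "h x"] by simp
    with \<open>x \<in> carrier M\<close> show "y \<in> h ` carrier M" by simp
  next
    assume "y \<in> h ` carrier M"
    then obtain x where "x \<in> carrier M" "y = h x" by blast
    then have "y \<oplus>\<^bsub>N\<^esub> h (\<ominus>\<^bsub>M\<^esub> x) = \<zero>\<^bsub>N\<^esub>"
      using m c assms(4) by (simp add: N.r_neg)
    with \<open>x \<in> carrier M\<close> show "\<exists>x\<in>carrier M. y \<oplus>\<^bsub>N\<^esub> h x = \<zero>\<^bsub>N\<^esub>" by blast
  qed
qed

text \<open>Every element of \<open>N\<close> is some \<open>h x\<close>, so each module axiom for
  \<open>N\<close> is the image of the same axiom for \<open>M\<close>. The definition of
  \<open>module_hom\<close> does not presuppose that its target is a module, so there is no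
  circularity.\<close>

lemma module_image:
  assumes "module R M" "h \<in> module_hom R M N"
    and "carrier N = h ` carrier M" "\<zero>\<^bsub>N\<^esub> = h \<zero>\<^bsub>M\<^esub>"
  shows "module R N"
proof -
  interpret M: module R M by fact
  have c: "h x \<in> carrier N" if "x \<in> carrier M" for x
    using that assms(3) by simp
  have a: "h x \<oplus>\<^bsub>N\<^esub> h y = h (x \<oplus>\<^bsub>M\<^esub> y)" if "x \<in> carrier M" "y \<in> carrier M" for x y
    using module_hom_add[OF assms(2) that] by simp
  have s: "r \<odot>\<^bsub>N\<^esub> h x = h (r \<odot>\<^bsub>M\<^esub> x)" if "r \<in> carrier R" "x \<in> carrier M" for r x
    using module_hom_smult[OF assms(2) that] by simp
  have "abelian_group N"
  proof (rule abelian_groupI)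
    fix x assume "x \<in> carrier N"
    then obtain x' where x': "x' \<in> carrier M" "x = h x'" using assms(3) by blast
    then have "h (\<ominus>\<^bsub>M\<^esub> x') \<oplus>\<^bsub>N\<^esub> x = \<zero>\<^bsub>N\<^esub>" by (simp add: a M.l_neg assms(4))
    then show "\<exists>y\<in>carrier N. y \<oplus>\<^bsub>N\<^esub> x = \<zero>\<^bsub>N\<^esub>" using x' c M.a_inv_closed by blast
  qed (auto simp: assms(3,4) a M.a_ac)
  then show ?thesis
    by (intro moduleI M.is_cring)
      (auto simp: assms(3) a s M.smult_l_distr M.smult_r_distr M.smult_assoc1)
qed

section \<open>Isomorphisms from two surjections with a common kernel\<close>

lemma (in abelian_group) minus_eq_zero_iff:
  assumes "x \<in> carrier G" "y \<in> carrier G"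
  shows "x \<ominus> y = \<zero> \<longleftrightarrow> x = y"
  using assms add.inv_solve_right[of \<zero> x y] by (auto simp: a_minus_def)

text \<open>First isomorphism theorem used twice: \<open>M\<close> and \<open>N\<close> are both
  \<open>Z\<close> modulo the same kernel. Stating it through \<open>f\<close> and \<open>h\<close>
  yields the formula for \<open>\<Phi>\<close> on representatives along with the
  isomorphism.\<close>

lemma module_iso_of_surj_homs:
  assumes "module R Z" "module R M" "module R N"
    and f: "f \<in> module_hom R Z M" "carrier M \<subseteq> f ` carrier Z"
    and h: "h \<in> module_hom R Z N" "carrier N \<subseteq> h ` carrier Z"
    and ker: "\<And>z. z \<in> carrier Z \<Longrightarrow> f z = \<zero>\<^bsub>M\<^esub> \<longleftrightarrow> h z = \<zero>\<^bsub>N\<^esub>"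
  shows "\<exists>\<Phi>\<in>module_iso R M N. \<forall>z\<in>carrier Z. \<Phi> (f z) = h z"
proof -
  interpret Z: module R Z by fact
  interpret M: module R M by fact
  interpret N: module R N by fact
  have fM: "carrier M = f ` carrier Z" and hN: "carrier N = h ` carrier Z"
    using f h by (auto simp: module_hom_closed)
  \<comment> \<open>Equal kernels give equal fibres, by applying \<open>ker\<close> to the
    difference of \<open>x\<close> and \<open>y\<close>.\<close>
  have eq: "f x = f y \<longleftrightarrow> h x = h y" if xy: "x \<in> carrier Z" "y \<in> carrier Z" for x y
  proof -
    have "f x = f y \<longleftrightarrow> f x \<ominus>\<^bsub>M\<^esub> f y = \<zero>\<^bsub>M\<^esub>"
      using M.minus_eq_zero_iff module_hom_closed[OF f(1)] xy by presburger
    also have "\<dots> \<longleftrightarrow> f (x \<ominus>\<^bsub>Z\<^esub> y) = \<zero>\<^bsub>M\<^esub>"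
      unfolding module_hom_diff[OF assms(1,2) f(1) xy] ..
    also have "\<dots> \<longleftrightarrow> h (x \<ominus>\<^bsub>Z\<^esub> y) = \<zero>\<^bsub>N\<^esub>"
      by (rule ker) (simp add: xy)
    also have "\<dots> \<longleftrightarrow> h x \<ominus>\<^bsub>N\<^esub> h y = \<zero>\<^bsub>N\<^esub>"
      unfolding module_hom_diff[OF assms(1,3) h(1) xy] ..
    also have "\<dots> \<longleftrightarrow> h x = h y"
      using N.minus_eq_zero_iff module_hom_closed[OF h(1)] xy by presburger
    finally show ?thesis .
  qed
  \<comment> \<open>An arbitrary preimage under \<open>f\<close> is chosen; by \<open>eq\<close> the
    value of \<open>h\<close> does not depend on it.\<close>
  define \<Phi> where "\<Phi> = h \<circ> inv_into (carrier Z) f"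
  have \<Phi>: "\<Phi> (f z) = h z" if z: "z \<in> carrier Z" for z
  proof -
    have "f (inv_into (carrier Z) f (f z)) = f z"
      by (rule f_inv_into_f) (rule imageI, fact z)
    moreover have "inv_into (carrier Z) f (f z) \<in> carrier Z"
      by (rule inv_into_into) (rule imageI, fact z)
    ultimately have "h (inv_into (carrier Z) f (f z)) = h z"
      using eq z by blast
    then show ?thesis by (simp add: \<Phi>_def)
  qed
  have "\<Phi> \<in> module_hom R M N"
  proof (rule module_homI)
    fix x y r assume x: "x \<in> carrier M"
    then obtain x' where x': "x' \<in> carrier Z" "x = f x'" using fM by blast
    then show "\<Phi> x \<in> carrier N" using h(1) by (simp add: \<Phi> module_hom_closed)
    show "\<Phi> (r \<odot>\<^bsub>M\<^esub> x) = r \<odot>\<^bsub>N\<^esub> \<Phi> x" if "r \<in> carrier R"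
      using that x' f(1) h(1) by (metis \<Phi> module_hom_smult Z.smult_closed)
    assume "y \<in> carrier M"
    then obtain y' where y': "y' \<in> carrier Z" "y = f y'" using fM by blast
    then show "\<Phi> (x \<oplus>\<^bsub>M\<^esub> y) = \<Phi> x \<oplus>\<^bsub>N\<^esub> \<Phi> y"
      using x' f(1) h(1) by (metis \<Phi> module_hom_add Z.a_closed)
  qed
  moreover have "bij_betw \<Phi> (carrier M) (carrier N)"
    unfolding bij_betw_def inj_on_def fM hN using \<Phi> eq by (auto simp: image_image)
  ultimately show ?thesis using \<Phi> by (auto simp: module_iso_def)
qed

section \<open>Quotient modules\<close>

lemma abelian_subgroup_submodule:
  assumes "module R M" "submodule B R M"
  shows "abelian_subgroup B M"
  using assms by (intro abelian_subgroupI3 additive_subgroupI) (simp_all add: module_def submodule_def)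

lemma carrier_quotient_module:
  "carrier (quotient_module M B) = (\<lambda>x. B +>\<^bsub>M\<^esub> x) ` carrier M"
  by (auto simp: quotient_module_def A_RCOSETS_def')

lemma mem_coset: "z \<in> B +>\<^bsub>M\<^esub> x \<longleftrightarrow> (\<exists>b\<in>B. z = b \<oplus>\<^bsub>M\<^esub> x)"
  by (auto simp: a_r_coset_def')

lemma coset_eq_iff:
  assumes "module R M" "submodule B R M" "x \<in> carrier M" "y \<in> carrier M"
  shows "B +>\<^bsub>M\<^esub> x = B +>\<^bsub>M\<^esub> y \<longleftrightarrow> (\<exists>b\<in>B. x = b \<oplus>\<^bsub>M\<^esub> y)"
proof -
  interpret abelian_subgroup B M by (rule abelian_subgroup_submodule) fact+
  have "B +>\<^bsub>M\<^esub> x = B +>\<^bsub>M\<^esub> y \<longleftrightarrow> x \<in> B +>\<^bsub>M\<^esub> y"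
    using assms(3,4) a_repr_independence' a_rcos_self a_subgroup by metis
  then show ?thesis unfolding mem_coset .
qed

lemma coset_eq_zero_iff:
  assumes "module R M" "submodule B R M" "x \<in> carrier M"
  shows "B +>\<^bsub>M\<^esub> x = \<zero>\<^bsub>quotient_module M B\<^esub> \<longleftrightarrow> x \<in> B"
proof -
  interpret abelian_subgroup B M by (rule abelian_subgroup_submodule) (rule assms)+
  have "B +>\<^bsub>M\<^esub> \<zero>\<^bsub>M\<^esub> = \<zero>\<^bsub>quotient_module M B\<^esub>"
    using a_coset_add_zero[OF a_subset] by (simp add: quotient_module_def)
  moreover have "(\<exists>b\<in>B. x = b \<oplus>\<^bsub>M\<^esub> \<zero>\<^bsub>M\<^esub>) \<longleftrightarrow> x \<in> B"
    using a_subset assms(3) by (auto simp: subset_iff)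
  ultimately show ?thesis using coset_eq_iff[OF assms, of "\<zero>\<^bsub>M\<^esub>"] by simp
qed

lemma coset_hom:
  assumes "module R M" "submodule B R M"
  shows "(\<lambda>x. B +>\<^bsub>M\<^esub> x) \<in> module_hom R M (quotient_module M B)"
proof (rule module_homI)
  interpret M: module R M by fact
  interpret abelian_subgroup B M by (rule abelian_subgroup_submodule) fact+
  fix x y r assume x: "x \<in> carrier M"
  then show "B +>\<^bsub>M\<^esub> x \<in> carrier (quotient_module M B)"
    by (simp add: carrier_quotient_module)
  show "B +>\<^bsub>M\<^esub> (x \<oplus>\<^bsub>M\<^esub> y) = (B +>\<^bsub>M\<^esub> x) \<oplus>\<^bsub>quotient_module M B\<^esub> (B +>\<^bsub>M\<^esub> y)"
    if "y \<in> carrier M"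
    using a_rcos_sum[OF x that] by (simp add: quotient_module_def)
  assume r: "r \<in> carrier R"
  \<comment> \<open>Scalar multiplication on the quotient is a union over all representatives
    \<open>z\<close> of the coset. As \<open>z\<close> and \<open>x\<close> differ by some
    \<open>b\<close> in \<open>B\<close>, their multiples differ by a multiple of \<open>b\<close>,
    again in \<open>B\<close>. So all sets in the union coincide with the coset of the multiple of
    \<open>x\<close>.\<close>
  have "B +>\<^bsub>M\<^esub> (r \<odot>\<^bsub>M\<^esub> z) = B +>\<^bsub>M\<^esub> (r \<odot>\<^bsub>M\<^esub> x)" if z: "z \<in> B +>\<^bsub>M\<^esub> x" for z
  proof -
    obtain b where b: "b \<in> B" "z = b \<oplus>\<^bsub>M\<^esub> x" using z unfolding mem_coset by blast
    then have "r \<odot>\<^bsub>M\<^esub> z = r \<odot>\<^bsub>M\<^esub> b \<oplus>\<^bsub>M\<^esub> r \<odot>\<^bsub>M\<^esub> x"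
      using r x by (simp add: M.smult_r_distr)
    moreover have "r \<odot>\<^bsub>M\<^esub> b \<in> B" using submodule.smult_closed[OF assms(2) r b(1)] .
    ultimately show ?thesis
      using coset_eq_iff[OF assms, of "r \<odot>\<^bsub>M\<^esub> z" "r \<odot>\<^bsub>M\<^esub> x"] r x b by auto
  qed
  then have "(\<Union>z\<in>B +>\<^bsub>M\<^esub> x. B +>\<^bsub>M\<^esub> (r \<odot>\<^bsub>M\<^esub> z)) = B +>\<^bsub>M\<^esub> (r \<odot>\<^bsub>M\<^esub> x)"
    using a_rcos_self[OF x] by blast
  then show "B +>\<^bsub>M\<^esub> (r \<odot>\<^bsub>M\<^esub> x) = r \<odot>\<^bsub>quotient_module M B\<^esub> (B +>\<^bsub>M\<^esub> x)"
    by (simp add: quotient_module_def)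
qed

text \<open>The axioms are transported along the surjective coset map instead of being checked on
  cosets.\<close>

lemma module_quotient_module:
  assumes "module R M" "submodule B R M"
  shows "module R (quotient_module M B)"
proof (rule module_image[OF assms(1) coset_hom[OF assms] carrier_quotient_module])
  interpret abelian_subgroup B M by (rule abelian_subgroup_submodule) fact+
  show "\<zero>\<^bsub>quotient_module M B\<^esub> = B +>\<^bsub>M\<^esub> \<zero>\<^bsub>M\<^esub>"
    using a_coset_add_zero[OF a_subset] by (simp add: quotient_module_def)
qed

section \<open>Maps induced on quotients\<close>

lemma induced_map_coset:
  assumes "module R M" "submodule A R M" "module R N" "submodule B R N"
    and "g \<in> module_hom R M N" "\<And>x. x \<in> A \<Longrightarrow> g x \<in> B" "x \<in> carrier M"
  shows "induced_map (\<lambda>y. B +>\<^bsub>N\<^esub> y) g (A +>\<^bsub>M\<^esub> x) = B +>\<^bsub>N\<^esub> g x"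
proof -
  interpret M: module R M by fact
  interpret abelian_subgroup A M by (rule abelian_subgroup_submodule) fact+
  \<comment> \<open>Independence of the representative: \<open>g z\<close> and \<open>g x\<close>
    differ by \<open>g a\<close>, which lies in \<open>B\<close> because \<open>g\<close> maps
    \<open>A\<close> into \<open>B\<close>.\<close>
  have "B +>\<^bsub>N\<^esub> g z = B +>\<^bsub>N\<^esub> g x" if z: "z \<in> A +>\<^bsub>M\<^esub> x" for z
  proof -
    obtain a where a: "a \<in> A" "z = a \<oplus>\<^bsub>M\<^esub> x" using z unfolding mem_coset by blast
    then have "a \<in> carrier M" "z \<in> carrier M" using assms(7) by auto
    then have "g z = g a \<oplus>\<^bsub>N\<^esub> g x" "g z \<in> carrier N" "g x \<in> carrier N"
      using a(2) assms(7) module_hom_add[OF assms(5)] module_hom_closed[OF assms(5)] by blast+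
    then show ?thesis
      using coset_eq_iff[OF assms(3,4)] assms(6)[OF a(1)] by blast
  qed
  \<comment> \<open>The image is a singleton, which is exactly what makes \<open>the_elem\<close> in
    \<open>induced_map\<close> return the intended class.\<close>
  then have "(\<lambda>y. B +>\<^bsub>N\<^esub> g y) ` (A +>\<^bsub>M\<^esub> x) = {B +>\<^bsub>N\<^esub> g x}"
    using a_rcos_self[OF assms(7)] by blast
  then show ?thesis by (simp add: induced_map_def)
qed

lemma induced_map_hom:
  assumes "module R M" "submodule A R M" "module R N" "submodule B R N"
    and "g \<in> module_hom R M N" "\<And>x. x \<in> A \<Longrightarrow> g x \<in> B"
  shows "induced_map (\<lambda>y. B +>\<^bsub>N\<^esub> y) g \<in> module_hom R (quotient_module M A) (quotient_module N B)"
proof (rule module_homI)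
  interpret M: module R M by fact
  note ind = induced_map_coset[OF assms]
  note homM = coset_hom[OF assms(1,2)] and homN = coset_hom[OF assms(3,4)]
  note hom = module_hom_comp[OF assms(5) homN]
  let ?i = "induced_map (\<lambda>y. B +>\<^bsub>N\<^esub> y) g" and ?Q = "quotient_module M A" and ?P = "quotient_module N B"
  fix X Y r assume "X \<in> carrier ?Q"
  then obtain x where x: "x \<in> carrier M" "X = A +>\<^bsub>M\<^esub> x" by (auto simp: carrier_quotient_module)
  then show "?i X \<in> carrier ?P"
    using ind module_hom_closed[OF hom] by simp
  show "?i (r \<odot>\<^bsub>?Q\<^esub> X) = r \<odot>\<^bsub>?P\<^esub> ?i X" if "r \<in> carrier R"
    using that x ind module_hom_smult[OF hom] by (simp add: module_hom_smult[OF homM, symmetric])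
  assume "Y \<in> carrier ?Q"
  then obtain y where "y \<in> carrier M" "Y = A +>\<^bsub>M\<^esub> y" by (auto simp: carrier_quotient_module)
  then show "?i (X \<oplus>\<^bsub>?Q\<^esub> Y) = ?i X \<oplus>\<^bsub>?P\<^esub> ?i Y"
    using x ind module_hom_add[OF hom] by (simp add: module_hom_add[OF homM, symmetric])
qed

text \<open>A coset depends only on the addition. This reconciles \<open>hclass1\<close>, formed in
  all of \<open>deg1 K\<close>, with \<open>homology1\<close>, formed from the record restricted to
  the cycles.\<close>

lemma a_r_coset_restrict: "a_r_coset (M\<lparr>carrier := Z\<rparr>) = a_r_coset M"
  by (simp add: a_r_coset_def' fun_eq_iff)

section \<open>Homology of three-term complexes\<close>

lemma chain_complex3D:
  assumes "chain_complex3 R K"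
  shows "module R (deg2 K)" "module R (deg1 K)" "module R (deg0 K)"
    "bd2 K \<in> module_hom R (deg2 K) (deg1 K)" "bd1 K \<in> module_hom R (deg1 K) (deg0 K)"
    "\<And>x. x \<in> carrier (deg2 K) \<Longrightarrow> bd1 K (bd2 K x) = \<zero>\<^bsub>deg0 K\<^esub>"
  using assms by (auto simp: chain_complex3_def)

context
  fixes R :: "('r, 'k) ring_scheme" and K :: "('r, 'a, 'b, 'c) complex3"
  assumes K: "chain_complex3 R K"
begin

lemma submodule_cycles2: "submodule (cycles2 K) R (deg2 K)"
  unfolding cycles2_def by (intro submodule_kernel chain_complex3D[OF K])

lemma submodule_cycles1: "submodule (cycles1 K) R (deg1 K)"
  unfolding cycles1_def by (intro submodule_kernel chain_complex3D[OF K])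

lemmas module_cycles2 =
  submodule.submodule_is_module[OF submodule_cycles2 chain_complex3D(1)[OF K]]

lemmas module_cycles1 =
  submodule.submodule_is_module[OF submodule_cycles1 chain_complex3D(2)[OF K]]

lemma submodule_boundaries2: "submodule (boundaries2 K) R (deg2 K\<lparr>carrier := cycles2 K\<rparr>)"
  using submodule_zero[OF module_cycles2] by (simp add: boundaries2_def)

text \<open>The vanishing of \<open>bd1 K (bd2 K x)\<close> enters here: it places the image of
  \<open>bd2\<close> inside the kernel of \<open>bd1\<close>.\<close>

lemma submodule_boundaries1: "submodule (boundaries1 K) R (deg1 K\<lparr>carrier := cycles1 K\<rparr>)"
  unfolding boundaries1_def
  by (rule submodule_restrict[OF chain_complex3D(2)[OF K] submodule_cycles1 submodule_image])
    (use chain_complex3D[OF K] in \<open>auto simp: cycles1_def mem_a_kernel module_hom_closed\<close>)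

lemma submodule_boundaries0: "submodule (boundaries0 K) R (deg0 K)"
  unfolding boundaries0_def by (intro submodule_image chain_complex3D[OF K])

lemma module_homology2: "module R (homology2 K)"
  unfolding homology2_def by (intro module_quotient_module module_cycles2 submodule_boundaries2)

lemma module_homology1: "module R (homology1 K)"
  unfolding homology1_def by (intro module_quotient_module module_cycles1 submodule_boundaries1)

lemma module_homology0: "module R (homology0 K)"
  using module_quotient_module[OF chain_complex3D(3)[OF K] submodule_boundaries0]
  by (simp add: homology0_def cycles0_def)

lemma hclass1_hom: "hclass1 K \<in> module_hom R (deg1 K\<lparr>carrier := cycles1 K\<rparr>) (homology1 K)"
  using coset_hom[OF module_cycles1 submodule_boundaries1]
  by (simp add: homology1_def hclass1_def[abs_def] a_r_coset_restrict)

lemma hclass1_eq_zero_iff: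
  "x \<in> cycles1 K \<Longrightarrow> hclass1 K x = \<zero>\<^bsub>homology1 K\<^esub> \<longleftrightarrow> x \<in> boundaries1 K"
  using coset_eq_zero_iff[OF module_cycles1 submodule_boundaries1]
  by (simp add: homology1_def hclass1_def a_r_coset_restrict)

lemma hclass1_eq_iff:
  "\<lbrakk>x \<in> cycles1 K; y \<in> cycles1 K\<rbrakk> \<Longrightarrow>
    hclass1 K x = hclass1 K y \<longleftrightarrow> (\<exists>b\<in>boundaries1 K. x = b \<oplus>\<^bsub>deg1 K\<^esub> y)"
  using coset_eq_iff[OF module_cycles1 submodule_boundaries1]
  by (simp add: hclass1_def a_r_coset_restrict)

lemma hclass0_eq_zero_iff:
  "x \<in> carrier (deg0 K) \<Longrightarrow> hclass0 K x = \<zero>\<^bsub>homology0 K\<^esub> \<longleftrightarrow> x \<in> boundaries0 K"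
  using coset_eq_zero_iff[OF chain_complex3D(3)[OF K] submodule_boundaries0]
  by (simp add: homology0_def cycles0_def hclass0_def)

lemma boundaries1_subset_cycles1: "boundaries1 K \<subseteq> cycles1 K"
  using submodule_subset[OF submodule_boundaries1] by simp

end

lemma carrier_homology2: "carrier (homology2 K) = hclass2 K ` cycles2 K"
  by (simp add: homology2_def hclass2_def[abs_def] carrier_quotient_module a_r_coset_restrict)

lemma carrier_homology1: "carrier (homology1 K) = hclass1 K ` cycles1 K"
  by (simp add: homology1_def hclass1_def[abs_def] carrier_quotient_module a_r_coset_restrict)

text \<open>The class of a cycle lies in the homology, hence is zero, hence the cycle is a boundary.
  In this form the two vanishing hypotheses of the theorem are used.\<close>

lemma cycles1_eq_boundaries1:
  assumes "chain_complex3 R K" "carrier (homology1 K) = {\<zero>\<^bsub>homology1 K\<^esub>}"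
  shows "cycles1 K = boundaries1 K"
proof
  show "cycles1 K \<subseteq> boundaries1 K"
  proof
    fix x assume x: "x \<in> cycles1 K"
    then have "hclass1 K x \<in> carrier (homology1 K)" by (simp add: carrier_homology1)
    then have "hclass1 K x = \<zero>\<^bsub>homology1 K\<^esub>" by (simp add: assms(2))
    with hclass1_eq_zero_iff[OF assms(1) x] show "x \<in> boundaries1 K" by simp
  qed
qed (rule boundaries1_subset_cycles1[OF assms(1)])

section \<open>The complex of homology modules\<close>

text \<open>These conditions on cycles and boundaries make the induced maps well defined and their
  composite zero. \<open>g2_boundaries\<close> and \<open>g1_cycles\<close> complete them:
  boundaries in degree 2 are zero, and everything in degree 0 is a cycle.\<close>

locale induced_complex =
  fixes R :: "('r, 'k) ring_scheme"
    and K2 :: "('r, 'a2, 'b2, 'c2) complex3" and K1 :: "('r, 'a1, 'b1, 'c1) complex3"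
    and K0 :: "('r, 'a0, 'b0, 'c0) complex3"
    and g2 :: "'a2 \<Rightarrow> 'b1" and g1 :: "'b1 \<Rightarrow> 'c0"
  assumes complexes: "chain_complex3 R K2" "chain_complex3 R K1" "chain_complex3 R K0"
    and g2_hom: "g2 \<in> module_hom R (deg2 K2) (deg1 K1)"
    and g1_hom: "g1 \<in> module_hom R (deg1 K1) (deg0 K0)"
    and g2_cycles: "\<And>x. x \<in> cycles2 K2 \<Longrightarrow> g2 x \<in> cycles1 K1"
    and g1_boundaries: "\<And>x. x \<in> boundaries1 K1 \<Longrightarrow> g1 x \<in> boundaries0 K0"
    and g1_g2: "\<And>x. x \<in> cycles2 K2 \<Longrightarrow> g1 (g2 x) \<in> boundaries0 K0"
begin

definition "Cg = homology_complex K2 K1 K0 g2 g1"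

lemma Cg_simps:
  "deg2 Cg = homology2 K2" "deg1 Cg = homology1 K1" "deg0 Cg = homology0 K0"
  "bd2 Cg = induced_map (hclass1 K1) g2" "bd1 Cg = induced_map (hclass0 K0) g1"
  by (simp_all add: Cg_def homology_complex_def)

lemma cycles1_closed: "x \<in> cycles1 K1 \<Longrightarrow> x \<in> carrier (deg1 K1)"
  by (simp add: cycles1_def mem_a_kernel)

lemma g1_cycles: "x \<in> cycles1 K1 \<Longrightarrow> g1 x \<in> cycles0 K0"
  using module_hom_closed[OF g1_hom] cycles1_closed by (simp add: cycles0_def)

lemma g2_restrict_hom:
  "g2 \<in> module_hom R (deg2 K2\<lparr>carrier := cycles2 K2\<rparr>) (deg1 K1\<lparr>carrier := cycles1 K1\<rparr>)"
  by (rule module_hom_restrict[OF g2_hom])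
    (auto simp: submodule_subset[OF submodule_cycles2[OF complexes(1)]] g2_cycles)

lemma g1_restrict_hom:
  "g1 \<in> module_hom R (deg1 K1\<lparr>carrier := cycles1 K1\<rparr>) (deg0 K0\<lparr>carrier := cycles0 K0\<rparr>)"
  by (rule module_hom_restrict[OF g1_hom])
    (auto simp: submodule_subset[OF submodule_cycles1[OF complexes(2)]] g1_cycles)

lemma g2_boundaries: "x \<in> boundaries2 K2 \<Longrightarrow> g2 x \<in> boundaries1 K1"
  using module_hom_zero[OF chain_complex3D(1)[OF complexes(1)] chain_complex3D(2)[OF complexes(2)] g2_hom]
    module_hom_zero[OF chain_complex3D(1,2,4)[OF complexes(2)]]
    abelian_monoid.zero_closed[of "deg2 K1"] chain_complex3D(1)[OF complexes(2)]
  by (auto simp: boundaries2_def boundaries1_def module_def abelian_group_def image_iff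
      intro!: bexI[of _ "\<zero>\<^bsub>deg2 K1\<^esub>"])

lemmas modules0 =
  chain_complex3D(3)[OF complexes(3)] submodule_boundaries0[OF complexes(3)]

lemma induced2_args:
  "module R (deg2 K2\<lparr>carrier := cycles2 K2\<rparr>)"
  "submodule (boundaries2 K2) R (deg2 K2\<lparr>carrier := cycles2 K2\<rparr>)"
  "module R (deg1 K1\<lparr>carrier := cycles1 K1\<rparr>)"
  "submodule (boundaries1 K1) R (deg1 K1\<lparr>carrier := cycles1 K1\<rparr>)"
  by (intro module_cycles2 module_cycles1 submodule_boundaries2 submodule_boundaries1 complexes)+

lemma induced1_args:
  "module R (deg0 K0\<lparr>carrier := cycles0 K0\<rparr>)"
  "submodule (boundaries0 K0) R (deg0 K0\<lparr>carrier := cycles0 K0\<rparr>)"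
  using modules0 by (simp_all add: cycles0_def)

lemma bd2_Cg: "x \<in> cycles2 K2 \<Longrightarrow> bd2 Cg (hclass2 K2 x) = hclass1 K1 (g2 x)"
  using induced_map_coset[OF induced2_args g2_restrict_hom g2_boundaries]
  by (simp add: Cg_simps hclass1_def[abs_def] hclass2_def a_r_coset_restrict)

lemma bd1_Cg: "x \<in> cycles1 K1 \<Longrightarrow> bd1 Cg (hclass1 K1 x) = hclass0 K0 (g1 x)"
  using induced_map_coset[OF induced2_args(3,4) induced1_args g1_restrict_hom g1_boundaries]
  by (simp add: Cg_simps hclass1_def hclass0_def[abs_def] a_r_coset_restrict)

lemma bd2_Cg_hom: "bd2 Cg \<in> module_hom R (homology2 K2) (homology1 K1)"
  using induced_map_hom[OF induced2_args g2_restrict_hom g2_boundaries]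
  by (simp add: Cg_simps homology2_def homology1_def hclass1_def[abs_def] a_r_coset_restrict)

lemma bd1_Cg_hom: "bd1 Cg \<in> module_hom R (homology1 K1) (homology0 K0)"
  using induced_map_hom[OF induced2_args(3,4) induced1_args g1_restrict_hom g1_boundaries]
  by (simp add: Cg_simps homology1_def homology0_def hclass0_def[abs_def] a_r_coset_restrict)

lemma chain_complex3_Cg: "chain_complex3 R Cg"
proof -
  have "bd1 Cg (bd2 Cg X) = \<zero>\<^bsub>homology0 K0\<^esub>" if "X \<in> carrier (homology2 K2)" for X
  proof -
    obtain x where x: "x \<in> cycles2 K2" "X = hclass2 K2 x"
      using \<open>X \<in> carrier (homology2 K2)\<close> by (auto simp: carrier_homology2)
    then have "bd1 Cg (bd2 Cg X) = hclass0 K0 (g1 (g2 x))"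
      by (simp add: bd2_Cg bd1_Cg g2_cycles)
    \<comment> \<open>On representatives the composite need not vanish; by \<open>g1_g2\<close> its
      values are boundaries of \<open>K0\<close>, so it vanishes on classes.\<close>
    also have "\<dots> = \<zero>\<^bsub>homology0 K0\<^esub>"
      using hclass0_eq_zero_iff[OF complexes(3)] g1_g2[OF x(1)] g1_cycles[OF g2_cycles[OF x(1)]]
      by (simp add: cycles0_def)
    finally show ?thesis .
  qed
  then show ?thesis
    using bd2_Cg_hom bd1_Cg_hom complexes
    by (auto simp: chain_complex3_def[of R Cg] Cg_simps module_homology2 module_homology1 module_homology0)
qed

text \<open>The class of \<open>x\<close> is sent to the class of \<open>g1 x\<close>, which is zero
  exactly for boundaries. This describes the kernel of the induced differential by
  representatives.\<close>

lemma hclass1_mem_cycles1_Cg_iff: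
  "x \<in> cycles1 K1 \<Longrightarrow> hclass1 K1 x \<in> cycles1 Cg \<longleftrightarrow> g1 x \<in> boundaries0 K0"
  using hclass0_eq_zero_iff[OF complexes(3)] g1_cycles
  by (auto simp: cycles1_def[of Cg] mem_a_kernel Cg_simps(2,3) bd1_Cg carrier_homology1 cycles0_def)

lemma cycles1_Cg: "cycles1 Cg = hclass1 K1 ` {x \<in> cycles1 K1. g1 x \<in> boundaries0 K0}"
proof -
  have "cycles1 Cg \<subseteq> hclass1 K1 ` cycles1 K1"
    by (auto simp: cycles1_def[of Cg] mem_a_kernel Cg_simps(2) carrier_homology1)
  then show ?thesis using hclass1_mem_cycles1_Cg_iff by blast
qed

text \<open>The boundaries of \<open>Cg\<close> are the classes of \<open>g2 y\<close> for cycles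
  \<open>y\<close>; the summand \<open>b\<close> accounts for equality of classes in the homology of
  \<open>K1\<close>.\<close>

lemma hclass1_mem_boundaries1_Cg_iff:
  assumes "x \<in> cycles1 K1"
  shows "hclass1 K1 x \<in> boundaries1 Cg \<longleftrightarrow>
    (\<exists>b\<in>boundaries1 K1. \<exists>y\<in>cycles2 K2. x = b \<oplus>\<^bsub>deg1 K1\<^esub> g2 y)"
proof -
  have "boundaries1 Cg = (\<lambda>y. hclass1 K1 (g2 y)) ` cycles2 K2"
    by (auto simp: boundaries1_def[of Cg] Cg_simps(1) carrier_homology2 bd2_Cg image_iff)
  then show ?thesis
    using hclass1_eq_iff[OF complexes(2) assms] g2_cycles by (auto simp: image_iff)
qed

end

section \<open>Lower-triangular complexes\<close>

text \<open>The data of the theorem over a general \<open>R\<close>. Signs therefore cannot be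
  dropped, and commutation with the differentials appears as a sum equal to zero.\<close>

locale triangular_complex =
  fixes R :: "('r, 'k) ring_scheme"
    and C22 :: "('r, 'a2) module" and C12 :: "('r, 'a1) module" and C02 :: "('r, 'a0) module"
    and C21 :: "('r, 'b2) module" and C11 :: "('r, 'b1) module" and C01 :: "('r, 'b0) module"
    and C20 :: "('r, 'c2) module" and C10 :: "('r, 'c1) module" and C00 :: "('r, 'c0) module"
    and C :: "('r, 'a2 \<times> 'a1 \<times> 'a0, 'b2 \<times> 'b1 \<times> 'b0, 'c2 \<times> 'c1 \<times> 'c0) complex3"
    and d22 :: "'a2 \<Rightarrow> 'b2" and d12 :: "'a1 \<Rightarrow> 'b1" and d02 :: "'a0 \<Rightarrow> 'b0"
    and g22 :: "'a2 \<Rightarrow> 'b1" and g12 :: "'a1 \<Rightarrow> 'b0" and p2 :: "'a2 \<Rightarrow> 'b0"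
    and d21 :: "'b2 \<Rightarrow> 'c2" and d11 :: "'b1 \<Rightarrow> 'c1" and d01 :: "'b0 \<Rightarrow> 'c0"
    and g21 :: "'b2 \<Rightarrow> 'c1" and g11 :: "'b1 \<Rightarrow> 'c0" and p1 :: "'b2 \<Rightarrow> 'c0"
  assumes spaces: "module R C22" "module R C12" "module R C02"
      "module R C21" "module R C11" "module R C01"
      "module R C20" "module R C10" "module R C00"
    and complex: "chain_complex3 R C"
    and sums: "deg2 C = C22 \<oplus>\<^sub>M C12 \<oplus>\<^sub>M C02"
      "deg1 C = C21 \<oplus>\<^sub>M C11 \<oplus>\<^sub>M C01"
      "deg0 C = C20 \<oplus>\<^sub>M C10 \<oplus>\<^sub>M C00"
    and matrix2:
      "lower_triangular R (C22, C12, C02) (C21, C11, C01) (bd2 C) d22 g22 d12 p2 g12 d02"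
    and matrix1:
      "lower_triangular R (C21, C11, C01) (C20, C10, C00) (bd1 C) d21 g21 d11 p1 g11 d01"
begin

interpretation C22: module R C22 by (rule spaces)
interpretation C12: module R C12 by (rule spaces)
interpretation C02: module R C02 by (rule spaces)
interpretation C21: module R C21 by (rule spaces)
interpretation C11: module R C11 by (rule spaces)
interpretation C01: module R C01 by (rule spaces)
interpretation C20: module R C20 by (rule spaces)
interpretation C10: module R C10 by (rule spaces)
interpretation C00: module R C00 by (rule spaces)

lemma homs:
  "d22 \<in> module_hom R C22 C21" "g22 \<in> module_hom R C22 C11" "d12 \<in> module_hom R C12 C11"
  "p2 \<in> module_hom R C22 C01" "g12 \<in> module_hom R C12 C01" "d02 \<in> module_hom R C02 C01"
  "d21 \<in> module_hom R C21 C20" "g21 \<in> module_hom R C21 C10" "d11 \<in> module_hom R C11 C10"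
  "p1 \<in> module_hom R C21 C00" "g11 \<in> module_hom R C11 C00" "d01 \<in> module_hom R C01 C00"
  using matrix2 matrix1 by (simp_all add: lower_triangular_def)

lemmas homs_closed [simp] = homs[THEN module_hom_closed]

lemma homs_zero [simp]:
  "d22 \<zero>\<^bsub>C22\<^esub> = \<zero>\<^bsub>C21\<^esub>" "g22 \<zero>\<^bsub>C22\<^esub> = \<zero>\<^bsub>C11\<^esub>" "d12 \<zero>\<^bsub>C12\<^esub> = \<zero>\<^bsub>C11\<^esub>"
  "p2 \<zero>\<^bsub>C22\<^esub> = \<zero>\<^bsub>C01\<^esub>" "g12 \<zero>\<^bsub>C12\<^esub> = \<zero>\<^bsub>C01\<^esub>" "d02 \<zero>\<^bsub>C02\<^esub> = \<zero>\<^bsub>C01\<^esub>"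
  "d21 \<zero>\<^bsub>C21\<^esub> = \<zero>\<^bsub>C20\<^esub>" "g21 \<zero>\<^bsub>C21\<^esub> = \<zero>\<^bsub>C10\<^esub>" "d11 \<zero>\<^bsub>C11\<^esub> = \<zero>\<^bsub>C10\<^esub>"
  "p1 \<zero>\<^bsub>C21\<^esub> = \<zero>\<^bsub>C00\<^esub>" "g11 \<zero>\<^bsub>C11\<^esub> = \<zero>\<^bsub>C00\<^esub>" "d01 \<zero>\<^bsub>C01\<^esub> = \<zero>\<^bsub>C00\<^esub>"
  by (rule homs[THEN module_hom_zero[rotated 2]]; rule spaces)+

lemma bd2_C:
  "\<lbrakk>x2 \<in> carrier C22; x1 \<in> carrier C12; x0 \<in> carrier C02\<rbrakk> \<Longrightarrow> bd2 C (x2, x1, x0) =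
    (d22 x2, g22 x2 \<oplus>\<^bsub>C11\<^esub> d12 x1, p2 x2 \<oplus>\<^bsub>C01\<^esub> g12 x1 \<oplus>\<^bsub>C01\<^esub> d02 x0)"
  using matrix2 by (simp add: lower_triangular_def)

lemma bd1_C:
  "\<lbrakk>y2 \<in> carrier C21; y1 \<in> carrier C11; y0 \<in> carrier C01\<rbrakk> \<Longrightarrow> bd1 C (y2, y1, y0) =
    (d21 y2, g21 y2 \<oplus>\<^bsub>C10\<^esub> d11 y1, p1 y2 \<oplus>\<^bsub>C00\<^esub> g11 y1 \<oplus>\<^bsub>C00\<^esub> d01 y0)"
  using matrix1 by (simp add: lower_triangular_def)

lemma sums_simps [simp]:
  "carrier (deg2 C) = carrier C22 \<times> carrier C12 \<times> carrier C02"
  "carrier (deg1 C) = carrier C21 \<times> carrier C11 \<times> carrier C01"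
  "carrier (deg0 C) = carrier C20 \<times> carrier C10 \<times> carrier C00"
  "\<zero>\<^bsub>deg1 C\<^esub> = (\<zero>\<^bsub>C21\<^esub>, \<zero>\<^bsub>C11\<^esub>, \<zero>\<^bsub>C01\<^esub>)"
  "\<zero>\<^bsub>deg0 C\<^esub> = (\<zero>\<^bsub>C20\<^esub>, \<zero>\<^bsub>C10\<^esub>, \<zero>\<^bsub>C00\<^esub>)"
  "(y2, y1, y0) \<oplus>\<^bsub>deg1 C\<^esub> (z2, z1, z0) = (y2 \<oplus>\<^bsub>C21\<^esub> z2, y1 \<oplus>\<^bsub>C11\<^esub> z1, y0 \<oplus>\<^bsub>C01\<^esub> z0)"
  "r \<odot>\<^bsub>deg1 C\<^esub> (y2, y1, y0) = (r \<odot>\<^bsub>C21\<^esub> y2, r \<odot>\<^bsub>C11\<^esub> y1, r \<odot>\<^bsub>C01\<^esub> y0)"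
  by (simp_all add: sums direct_sum_def)

section \<open>The entries of the squared differential\<close>

lemma bd1_bd2:
  "\<lbrakk>x2 \<in> carrier C22; x1 \<in> carrier C12; x0 \<in> carrier C02\<rbrakk> \<Longrightarrow>
    bd1 C (bd2 C (x2, x1, x0)) = (\<zero>\<^bsub>C20\<^esub>, \<zero>\<^bsub>C10\<^esub>, \<zero>\<^bsub>C00\<^esub>)"
  using chain_complex3D(6)[OF complex, of "(x2, x1, x0)"] by simp

text \<open>First column of the matrix product, read off by evaluating on an element supported in
  \<open>C22\<close>. The next two lemmas treat the second and third columns in the same
  way.\<close>

lemma relations2:
  assumes "x \<in> carrier C22"
  shows "d21 (d22 x) = \<zero>\<^bsub>C20\<^esub>"
    and "g21 (d22 x) \<oplus>\<^bsub>C10\<^esub> d11 (g22 x) = \<zero>\<^bsub>C10\<^esub>"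
    and "p1 (d22 x) \<oplus>\<^bsub>C00\<^esub> g11 (g22 x) \<oplus>\<^bsub>C00\<^esub> d01 (p2 x) = \<zero>\<^bsub>C00\<^esub>"
  using bd1_bd2[of x "\<zero>\<^bsub>C12\<^esub>" "\<zero>\<^bsub>C02\<^esub>"] assms by (simp_all add: bd2_C bd1_C)

lemma relations1:
  assumes "x \<in> carrier C12"
  shows "d11 (d12 x) = \<zero>\<^bsub>C10\<^esub>" and "g11 (d12 x) \<oplus>\<^bsub>C00\<^esub> d01 (g12 x) = \<zero>\<^bsub>C00\<^esub>"
  using bd1_bd2[of "\<zero>\<^bsub>C22\<^esub>" x "\<zero>\<^bsub>C02\<^esub>"] assms by (simp_all add: bd2_C bd1_C)

lemma relations0:
  assumes "x \<in> carrier C02"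
  shows "d01 (d02 x) = \<zero>\<^bsub>C00\<^esub>"
  using bd1_bd2[of "\<zero>\<^bsub>C22\<^esub>" "\<zero>\<^bsub>C12\<^esub>" x] assms by (simp_all add: bd2_C bd1_C)

section \<open>The diagonal complexes and the maps between their homologies\<close>

definition "K2 = \<lparr>deg2 = C22, deg1 = C21, deg0 = C20, bd2 = d22, bd1 = d21\<rparr>"
definition "K1 = \<lparr>deg2 = C12, deg1 = C11, deg0 = C10, bd2 = d12, bd1 = d11\<rparr>"
definition "K0 = \<lparr>deg2 = C02, deg1 = C01, deg0 = C00, bd2 = d02, bd1 = d01\<rparr>"

lemma chain_complex3_K:
  "chain_complex3 R K2" "chain_complex3 R K1" "chain_complex3 R K0"
  using spaces homs relations2(1) relations1(1) relations0
  by (simp_all add: chain_complex3_def K2_def K1_def K0_def)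

lemma mem_cycles:
  "x \<in> cycles2 K2 \<longleftrightarrow> x \<in> carrier C22 \<and> d22 x = \<zero>\<^bsub>C21\<^esub>"
  "y \<in> cycles1 K2 \<longleftrightarrow> y \<in> carrier C21 \<and> d21 y = \<zero>\<^bsub>C20\<^esub>"
  "z \<in> cycles1 K1 \<longleftrightarrow> z \<in> carrier C11 \<and> d11 z = \<zero>\<^bsub>C10\<^esub>"
  "w \<in> cycles1 K0 \<longleftrightarrow> w \<in> carrier C01 \<and> d01 w = \<zero>\<^bsub>C00\<^esub>"
  by (simp_all add: cycles2_def cycles1_def mem_a_kernel K2_def K1_def K0_def)

lemma boundaries_K:
  "boundaries1 K2 = d22 ` carrier C22"
  "boundaries1 K1 = d12 ` carrier C12"
  "boundaries1 K0 = d02 ` carrier C02"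
  "boundaries0 K0 = d01 ` carrier C01"
  by (simp_all add: boundaries1_def boundaries0_def K2_def K1_def K0_def)

lemma mem_boundaries0_K0:
  "z \<in> carrier C00 \<Longrightarrow>
    z \<in> boundaries0 K0 \<longleftrightarrow> (\<exists>y\<in>carrier C01. z \<oplus>\<^bsub>C00\<^esub> d01 y = \<zero>\<^bsub>C00\<^esub>)"
  using add_hom_eq_zero_iff_mem_image[OF spaces(6,9) homs(12)] by (simp add: boundaries_K)

sublocale induced: induced_complex R K2 K1 K0 g22 g11
proof
  show "g22 \<in> module_hom R (deg2 K2) (deg1 K1)" "g11 \<in> module_hom R (deg1 K1) (deg0 K0)"
    using homs by (simp_all add: K2_def K1_def K0_def)
  \<comment> \<open>For a cycle \<open>x\<close> the term \<open>g21 (d22 x)\<close> is zero, so the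
    middle entry of the first column leaves \<open>d11 (g22 x)\<close> equal to zero.\<close>
  show "g22 x \<in> cycles1 K1" if "x \<in> cycles2 K2" for x
    using that relations2(2)[of x] by (simp add: mem_cycles)
  \<comment> \<open>With \<open>d22 x\<close> zero, the bottom entry of the first column shows that
    \<open>p2 x\<close> is the required witness: \<open>p\<close> is the homotopy.\<close>
  show "g11 (g22 x) \<in> boundaries0 K0" if "x \<in> cycles2 K2" for x
    using that relations2(3)[of x] by (auto simp: mem_cycles mem_boundaries0_K0)
  \<comment> \<open>For \<open>y = d12 x\<close> the witness is \<open>g12 x\<close>, by the bottom
    entry of the second column.\<close>
  show "g11 y \<in> boundaries0 K0" if y: "y \<in> boundaries1 K1" for y
  proof -
    obtain x where x: "x \<in> carrier C12" "y = d12 x" using y by (auto simp: boundaries_K)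
    then show ?thesis using relations1(2)[of x] homs_closed(5)[of x] by (auto simp: mem_boundaries0_K0)
  qed
qed (rule chain_complex3_K)+

section \<open>Degree-1 cycles and boundaries of \<open>C\<close> with vanishing first
  component\<close>

lemma mem_cycles1_C:
  "\<lbrakk>y \<in> carrier C11; z \<in> carrier C01\<rbrakk> \<Longrightarrow> (\<zero>\<^bsub>C21\<^esub>, y, z) \<in> cycles1 C \<longleftrightarrow>
    d11 y = \<zero>\<^bsub>C10\<^esub> \<and> g11 y \<oplus>\<^bsub>C00\<^esub> d01 z = \<zero>\<^bsub>C00\<^esub>"
  by (simp add: cycles1_def mem_a_kernel bd1_C)

text \<open>The first component of a boundary is \<open>d22 x2\<close>, so its vanishing says that
  \<open>x2\<close> is a cycle of \<open>K2\<close>; \<open>x1\<close> and \<open>x0\<close> remain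
  free.\<close>

lemma mem_boundaries1_C:
  "(\<zero>\<^bsub>C21\<^esub>, y, z) \<in> boundaries1 C \<longleftrightarrow>
    (\<exists>x2\<in>cycles2 K2. \<exists>x1\<in>carrier C12. \<exists>x0\<in>carrier C02.
      y = g22 x2 \<oplus>\<^bsub>C11\<^esub> d12 x1 \<and> z = p2 x2 \<oplus>\<^bsub>C01\<^esub> g12 x1 \<oplus>\<^bsub>C01\<^esub> d02 x0)"
  by (force simp: boundaries1_def bd2_C mem_cycles)

text \<open>The module \<open>Z\<close> that maps onto both homologies. Its elements encode the
  pairs of \<open>l1\<close> and an admissible \<open>l0\<close> from the theorem.\<close>

definition reduced_cycles :: "('b2 \<times> 'b1 \<times> 'b0) set" where
  "reduced_cycles = {c \<in> cycles1 C. fst c = \<zero>\<^bsub>C21\<^esub>}"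

text \<open>It is the kernel of the first projection, restricted to the cycles.\<close>

lemma submodule_reduced_cycles: "submodule reduced_cycles R (deg1 C\<lparr>carrier := cycles1 C\<rparr>)"
proof -
  have "fst \<in> module_hom R (deg1 C\<lparr>carrier := cycles1 C\<rparr>) C21"
    by (rule module_homI) (auto simp: cycles1_def mem_a_kernel)
  then have "submodule (a_kernel (deg1 C\<lparr>carrier := cycles1 C\<rparr>) C21 fst) R (deg1 C\<lparr>carrier := cycles1 C\<rparr>)"
    by (rule submodule_kernel[OF module_cycles1[OF complex] spaces(4)])
  moreover have "a_kernel (deg1 C\<lparr>carrier := cycles1 C\<rparr>) C21 fst = reduced_cycles"
    by (auto simp: mem_a_kernel reduced_cycles_def)
  ultimately show ?thesis by simp
qed

lemma module_reduced_cycles: "module R (deg1 C\<lparr>carrier := reduced_cycles\<rparr>)"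
  using submodule.submodule_is_module[OF submodule_reduced_cycles module_cycles1[OF complex]] by simp

lemma mem_reduced_cycles:
  "c \<in> reduced_cycles \<longleftrightarrow> (\<exists>y z. c = (\<zero>\<^bsub>C21\<^esub>, y, z) \<and> y \<in> cycles1 K1 \<and> z \<in> carrier C01 \<and>
    g11 y \<oplus>\<^bsub>C00\<^esub> d01 z = \<zero>\<^bsub>C00\<^esub>)"
proof (cases c)
  case (fields x y z)
  then show ?thesis
    by (auto simp: reduced_cycles_def mem_cycles mem_cycles1_C) (auto simp: cycles1_def mem_a_kernel bd1_C)
qed

text \<open>A composite of three homomorphisms: projection to the middle component, passage to the
  homology of \<open>K1\<close>, and passage to the homology of \<open>Cg\<close>.\<close>

lemma hclass1_Cg_hom:
  "(\<lambda>c. hclass1 induced.Cg (hclass1 K1 (fst (snd c))))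
    \<in> module_hom R (deg1 C\<lparr>carrier := reduced_cycles\<rparr>) (homology1 induced.Cg)"
proof -
  have "(\<lambda>c. fst (snd c)) \<in> module_hom R (deg1 C\<lparr>carrier := reduced_cycles\<rparr>) (deg1 K1\<lparr>carrier := cycles1 K1\<rparr>)"
    by (rule module_homI) (auto simp: mem_reduced_cycles, simp_all add: K1_def)
  from module_hom_comp[OF this hclass1_hom[OF chain_complex3_K(2)]]
  have "(\<lambda>c. hclass1 K1 (fst (snd c))) \<in> module_hom R (deg1 C\<lparr>carrier := reduced_cycles\<rparr>) (deg1 induced.Cg)"
    by (simp add: induced.Cg_simps)
  \<comment> \<open>The third component \<open>z\<close> witnesses that \<open>g11 y\<close> is a
    boundary, so the class of \<open>y\<close> is a cycle of \<open>Cg\<close> and has a class in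
    its homology.\<close>
  moreover have "hclass1 K1 (fst (snd c)) \<in> cycles1 induced.Cg" if c: "c \<in> reduced_cycles" for c
  proof -
    obtain y z where "c = (\<zero>\<^bsub>C21\<^esub>, y, z)" "y \<in> cycles1 K1" "z \<in> carrier C01"
        "g11 y \<oplus>\<^bsub>C00\<^esub> d01 z = \<zero>\<^bsub>C00\<^esub>"
      using c by (auto simp: mem_reduced_cycles)
    then show ?thesis
      by (auto simp: induced.hclass1_mem_cycles1_Cg_iff mem_boundaries0_K0 mem_cycles)
  qed
  ultimately
  have "(\<lambda>c. hclass1 K1 (fst (snd c))) \<in> module_hom R (deg1 C\<lparr>carrier := reduced_cycles\<rparr>)
      (deg1 induced.Cg\<lparr>carrier := cycles1 induced.Cg\<rparr>)"
    by (simp add: module_hom_def Pi_iff)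
  from module_hom_comp[OF this hclass1_hom[OF induced.chain_complex3_Cg]] show ?thesis .
qed

lemma hclass1_C_hom: "hclass1 C \<in> module_hom R (deg1 C\<lparr>carrier := reduced_cycles\<rparr>) (homology1 C)"
  using module_hom_restrict[OF hclass1_hom[OF complex], of reduced_cycles "carrier (homology1 C)"]
    module_hom_closed[OF hclass1_hom[OF complex]]
  by (auto simp: reduced_cycles_def)

section \<open>Surjectivity onto both homologies\<close>

lemma homology1_Cg_surj:
  "carrier (homology1 induced.Cg) \<subseteq> (\<lambda>c. hclass1 induced.Cg (hclass1 K1 (fst (snd c)))) ` reduced_cycles"
proof
  fix X assume "X \<in> carrier (homology1 induced.Cg)"
  then obtain y where y: "y \<in> cycles1 K1" "g11 y \<in> boundaries0 K0" "X = hclass1 induced.Cg (hclass1 K1 y)"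
    by (auto simp: carrier_homology1 induced.cycles1_Cg)
  \<comment> \<open>Lying in the kernel of the induced map provides the third component that
    completes \<open>y\<close> to a cycle of \<open>C\<close>.\<close>
  then obtain z where "z \<in> carrier C01" "g11 y \<oplus>\<^bsub>C00\<^esub> d01 z = \<zero>\<^bsub>C00\<^esub>"
    by (auto simp: mem_boundaries0_K0 mem_cycles)
  with y(1) have "(\<zero>\<^bsub>C21\<^esub>, y, z) \<in> reduced_cycles" by (simp add: mem_reduced_cycles)
  with y(3) show "X \<in> (\<lambda>c. hclass1 induced.Cg (hclass1 K1 (fst (snd c)))) ` reduced_cycles"
    by force
qed

lemma homology1_C_surj:
  assumes "cycles1 K2 = boundaries1 K2"
  shows "carrier (homology1 C) \<subseteq> hclass1 C ` reduced_cycles"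
proof
  fix X assume "X \<in> carrier (homology1 C)"
  then obtain c where c: "c \<in> cycles1 C" "X = hclass1 C c" by (auto simp: carrier_homology1)
  obtain y2 y1 y0 where y: "c = (y2, y1, y0)" by (cases c) auto
  have y_carrier: "y2 \<in> carrier C21" "y1 \<in> carrier C11" "y0 \<in> carrier C01"
    using c(1) by (auto simp: y cycles1_def mem_a_kernel)
  then have "y2 \<in> cycles1 K2"
    using c(1) by (simp add: y cycles1_def[of C] mem_a_kernel bd1_C mem_cycles)
  then obtain x where x: "x \<in> carrier C22" "y2 = d22 x" using assms by (auto simp: boundaries_K)
  \<comment> \<open>The boundary \<open>b\<close> has first component the negative of
    \<open>y2\<close>. Adding it to \<open>c\<close> clears the first component without changing the
    homology class.\<close>
  define b where "b = bd2 C (\<ominus>\<^bsub>C22\<^esub> x, \<zero>\<^bsub>C12\<^esub>, \<zero>\<^bsub>C02\<^esub>)"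
  have b: "b \<in> boundaries1 C" using x(1) by (auto simp: b_def boundaries1_def)
  then have b': "b \<in> cycles1 C" using boundaries1_subset_cycles1[OF complex] by blast
  interpret Z: module R "deg1 C\<lparr>carrier := cycles1 C\<rparr>" by (rule module_cycles1[OF complex])
  have bc: "b \<oplus>\<^bsub>deg1 C\<^esub> c \<in> cycles1 C" using Z.a_closed[of b c] b' c(1) by simp
  have "fst (b \<oplus>\<^bsub>deg1 C\<^esub> c) = d22 (\<ominus>\<^bsub>C22\<^esub> x) \<oplus>\<^bsub>C21\<^esub> y2"
    using x(1) by (simp add: b_def bd2_C y)
  also have "\<dots> = \<zero>\<^bsub>C21\<^esub>"
    using x module_hom_minus[OF spaces(1,4) homs(1) x(1)] by (simp add: C21.l_neg)
  finally have "b \<oplus>\<^bsub>deg1 C\<^esub> c \<in> reduced_cycles" using bc by (simp add: reduced_cycles_def)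
  moreover have "hclass1 C (b \<oplus>\<^bsub>deg1 C\<^esub> c) = X"
    using hclass1_eq_iff[OF complex bc c(1)] b c(2) by blast
  ultimately show "X \<in> hclass1 C ` reduced_cycles" by blast
qed

text \<open>Both sides amount to \<open>y\<close> being a sum of some \<open>d12 x1\<close> and some
  \<open>g22 x2\<close> with \<open>x2\<close> a cycle. For the class in \<open>C\<close> the third
  component must match as well, and vanishing homology of \<open>K0\<close> allows it to be
  corrected.\<close>

lemma kernels_eq:
  assumes "cycles1 K0 = boundaries1 K0" "c \<in> reduced_cycles"
  shows "hclass1 induced.Cg (hclass1 K1 (fst (snd c))) = \<zero>\<^bsub>homology1 induced.Cg\<^esub> \<longleftrightarrow>
    hclass1 C c = \<zero>\<^bsub>homology1 C\<^esub>"
proof -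
  obtain y z where c: "c = (\<zero>\<^bsub>C21\<^esub>, y, z)" "y \<in> cycles1 K1" "z \<in> carrier C01"
      "g11 y \<oplus>\<^bsub>C00\<^esub> d01 z = \<zero>\<^bsub>C00\<^esub>"
    using assms(2) by (auto simp: mem_reduced_cycles)
  have y: "y \<in> carrier C11" "d11 y = \<zero>\<^bsub>C10\<^esub>" using c(2) by (simp_all add: mem_cycles)
  have "hclass1 K1 y \<in> cycles1 induced.Cg"
    using c y by (auto simp: induced.hclass1_mem_cycles1_Cg_iff mem_boundaries0_K0)
  then have "hclass1 induced.Cg (hclass1 K1 y) = \<zero>\<^bsub>homology1 induced.Cg\<^esub> \<longleftrightarrow>
      hclass1 K1 y \<in> boundaries1 induced.Cg"
    by (rule hclass1_eq_zero_iff[OF induced.chain_complex3_Cg])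
  also have "\<dots> \<longleftrightarrow> (\<exists>x2\<in>cycles2 K2. \<exists>x1\<in>carrier C12. y = d12 x1 \<oplus>\<^bsub>C11\<^esub> g22 x2)"
    unfolding induced.hclass1_mem_boundaries1_Cg_iff[OF c(2)] boundaries_K by (auto simp: K1_def)
  also have "\<dots> \<longleftrightarrow> c \<in> boundaries1 C"
  proof
    assume "\<exists>x2\<in>cycles2 K2. \<exists>x1\<in>carrier C12. y = d12 x1 \<oplus>\<^bsub>C11\<^esub> g22 x2"
    then obtain x2 x1 where x: "x2 \<in> cycles2 K2" "x1 \<in> carrier C12" "y = d12 x1 \<oplus>\<^bsub>C11\<^esub> g22 x2"
      by blast
    then have x2: "x2 \<in> carrier C22" by (simp add: mem_cycles)
    have yx: "y = g22 x2 \<oplus>\<^bsub>C11\<^esub> d12 x1" using x x2 by (simp add: C11.a_comm)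
    \<comment> \<open>\<open>(0, y, m)\<close> is a boundary, and \<open>z - m\<close> is a cycle of \<open>K0\<close>.\<close>
    define m where "m = p2 x2 \<oplus>\<^bsub>C01\<^esub> g12 x1"
    have m: "m \<in> carrier C01" using x x2 by (simp add: m_def)
    have "(\<zero>\<^bsub>C21\<^esub>, y, m) \<in> boundaries1 C"
      using x yx m_def m by (auto simp: mem_boundaries1_C intro!: bexI[of _ x2] bexI[of _ x1] bexI[of _ "\<zero>\<^bsub>C02\<^esub>"])
    then have "(\<zero>\<^bsub>C21\<^esub>, y, m) \<in> cycles1 C"
      using boundaries1_subset_cycles1[OF complex] by blast
    \<comment> \<open>Both \<open>(0, y, m)\<close> and \<open>c\<close> are cycles with the same
      middle component, so both sums are zero and \<open>g11 y\<close> cancels.\<close>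
    then have "g11 y \<oplus>\<^bsub>C00\<^esub> d01 m = g11 y \<oplus>\<^bsub>C00\<^esub> d01 z"
      using y(1) m c(4) by (simp add: mem_cycles1_C)
    then have "d01 m = d01 z" using y(1) m c(3) by simp
    then have "d01 (z \<ominus>\<^bsub>C01\<^esub> m) = \<zero>\<^bsub>C00\<^esub>"
      using module_hom_diff[OF spaces(6,9) homs(12) c(3) m] m c(3) C00.minus_eq_zero_iff by simp
    \<comment> \<open>Here the vanishing homology of \<open>K0\<close> is used; the resulting
      \<open>x0\<close> corrects the third component from \<open>m\<close> to
      \<open>z\<close>.\<close>
    then have "z \<ominus>\<^bsub>C01\<^esub> m \<in> d02 ` carrier C02"
      using assms(1) m c(3) by (metis C01.minus_closed boundaries_K(3) mem_cycles(4))
    then obtain x0 where x0: "x0 \<in> carrier C02" "d02 x0 = z \<ominus>\<^bsub>C01\<^esub> m" by auto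
    have z: "z = m \<oplus>\<^bsub>C01\<^esub> d02 x0"
      using C01.a_lcomm[of m z "\<ominus>\<^bsub>C01\<^esub> m"] m c(3) by (simp add: x0(2) a_minus_def C01.r_neg)
    then show "c \<in> boundaries1 C"
      unfolding c(1) mem_boundaries1_C using x(1,2) yx x0(1) z[unfolded m_def] by blast
  next
    assume "c \<in> boundaries1 C"
    then obtain x2 x1 where x: "x2 \<in> cycles2 K2" "x1 \<in> carrier C12" "y = g22 x2 \<oplus>\<^bsub>C11\<^esub> d12 x1"
      by (auto simp: c(1) mem_boundaries1_C)
    then have "y = d12 x1 \<oplus>\<^bsub>C11\<^esub> g22 x2" by (simp add: mem_cycles C11.a_comm)
    with x show "\<exists>x2\<in>cycles2 K2. \<exists>x1\<in>carrier C12. y = d12 x1 \<oplus>\<^bsub>C11\<^esub> g22 x2" by blast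
  qed
  also have "\<dots> \<longleftrightarrow> hclass1 C c = \<zero>\<^bsub>homology1 C\<^esub>"
    using hclass1_eq_zero_iff[OF complex] assms(2) by (simp add: reduced_cycles_def)
  finally show ?thesis by (simp add: c(1))
qed

text \<open>The reduced cycles are the common source. Vanishing for \<open>K2\<close> gives
  surjectivity onto the homology of \<open>C\<close>, and vanishing for \<open>K0\<close> gives
  equality of the kernels.\<close>

lemma homology1_iso:
  assumes "carrier (homology1 K0) = {\<zero>\<^bsub>homology1 K0\<^esub>}"
    and "carrier (homology1 K2) = {\<zero>\<^bsub>homology1 K2\<^esub>}"
  shows "\<exists>\<Phi>\<in>module_iso R (homology1 induced.Cg) (homology1 C). \<forall>c\<in>reduced_cycles.
    \<Phi> (hclass1 induced.Cg (hclass1 K1 (fst (snd c)))) = hclass1 C c"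
proof -
  note H = cycles1_eq_boundaries1[OF chain_complex3_K(3) assms(1)]
    cycles1_eq_boundaries1[OF chain_complex3_K(1) assms(2)]
  have c: "carrier (deg1 C\<lparr>carrier := reduced_cycles\<rparr>) = reduced_cycles" by simp
  show ?thesis
    by (rule module_iso_of_surj_homs[OF module_reduced_cycles
          module_homology1[OF induced.chain_complex3_Cg] module_homology1[OF complex]
          hclass1_Cg_hom _ hclass1_C_hom, unfolded c])
      (rule homology1_Cg_surj homology1_C_surj[OF H(2)] kernels_eq[OF H(1)], assumption?)+
qed

end

section \<open>Specialization to the field with two elements\<close>

theorem theoremI1:
  \<comment> \<open>In a name with two indices, the first is the filtration index \<open>s\<close> and the second the degree:
    \<open>C\<^sub>s\<^sub>i\<close> is the summand of type \<open>s\<close> in degree \<open>i\<close>, and the second index of a map is the degree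
    of its source.\<close>
  fixes C22 :: "(int, 'a2) module" and C12 :: "(int, 'a1) module" and C02 :: "(int, 'a0) module"
    and C21 :: "(int, 'b2) module" and C11 :: "(int, 'b1) module" and C01 :: "(int, 'b0) module"
    and C20 :: "(int, 'c2) module" and C10 :: "(int, 'c1) module" and C00 :: "(int, 'c0) module"
    and C :: "(int, 'a2 \<times> 'a1 \<times> 'a0, 'b2 \<times> 'b1 \<times> 'b0, 'c2 \<times> 'c1 \<times> 'c0) complex3"
    and d22 :: "'a2 \<Rightarrow> 'b2" and d12 :: "'a1 \<Rightarrow> 'b1" and d02 :: "'a0 \<Rightarrow> 'b0"
    and g22 :: "'a2 \<Rightarrow> 'b1" and g12 :: "'a1 \<Rightarrow> 'b0" and p2 :: "'a2 \<Rightarrow> 'b0"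
    and d21 :: "'b2 \<Rightarrow> 'c2" and d11 :: "'b1 \<Rightarrow> 'c1" and d01 :: "'b0 \<Rightarrow> 'c0"
    and g21 :: "'b2 \<Rightarrow> 'c1" and g11 :: "'b1 \<Rightarrow> 'c0" and p1 :: "'b2 \<Rightarrow> 'c0"
    and K2 :: "(int, 'a2, 'b2, 'c2) complex3"
    and K1 :: "(int, 'a1, 'b1, 'c1) complex3"
    and K0 :: "(int, 'a0, 'b0, 'c0) complex3"
    and Cg :: "(int, 'a2 set, 'b1 set, 'c0 set) complex3"
  assumes spaces2: "module F2 C22" "module F2 C12" "module F2 C02"
    and spaces1: "module F2 C21" "module F2 C11" "module F2 C01"
    and spaces0: "module F2 C20" "module F2 C10" "module F2 C00"
    and complex: "chain_complex3 F2 C"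
    and sums: "deg2 C = C22 \<oplus>\<^sub>M C12 \<oplus>\<^sub>M C02"
              "deg1 C = C21 \<oplus>\<^sub>M C11 \<oplus>\<^sub>M C01"
              "deg0 C = C20 \<oplus>\<^sub>M C10 \<oplus>\<^sub>M C00"
    and matrix2: "lower_triangular F2 (C22, C12, C02) (C21, C11, C01) (bd2 C)
                    d22
                    g22 d12
                    p2 g12 d02"
    and matrix1: "lower_triangular F2 (C21, C11, C01) (C20, C10, C00) (bd1 C)
                    d21
                    g21 d11
                    p1 g11 d01"
    and K2: "K2 = \<lparr>deg2 = C22, deg1 = C21, deg0 = C20, bd2 = d22, bd1 = d21\<rparr>"
    and K1: "K1 = \<lparr>deg2 = C12, deg1 = C11, deg0 = C10, bd2 = d12, bd1 = d11\<rparr>"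
    and K0: "K0 = \<lparr>deg2 = C02, deg1 = C01, deg0 = C00, bd2 = d02, bd1 = d01\<rparr>"
    and Cg: "Cg = homology_complex K2 K1 K0 g22 g11"
  shows "chain_complex3 F2 K2 \<and> chain_complex3 F2 K1 \<and> chain_complex3 F2 K0 \<and>
    (\<forall>l\<in>cycles2 K2. g22 l \<in> cycles1 K1 \<and> bd2 Cg (hclass2 K2 l) = hclass1 K1 (g22 l)) \<and>
    (\<forall>l\<in>cycles1 K1. g11 l \<in> cycles0 K0 \<and> bd1 Cg (hclass1 K1 l) = hclass0 K0 (g11 l)) \<and>
    chain_complex3 F2 Cg \<and>
    (carrier (homology1 K0) = {\<zero>\<^bsub>homology1 K0\<^esub>} \<and> carrier (homology1 K2) = {\<zero>\<^bsub>homology1 K2\<^esub>} \<longrightarrow>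
      (\<forall>l1\<in>cycles1 K1. hclass1 K1 l1 \<in> cycles1 Cg \<longrightarrow>
        (\<exists>l0\<in>carrier C01. g11 l1 \<oplus>\<^bsub>C00\<^esub> d01 l0 = \<zero>\<^bsub>C00\<^esub>)) \<and>
      (\<exists>\<Phi>\<in>module_iso F2 (homology1 Cg) (homology1 C).
        \<forall>l1\<in>cycles1 K1. hclass1 K1 l1 \<in> cycles1 Cg \<longrightarrow>
          (\<forall>l0\<in>carrier C01. g11 l1 \<oplus>\<^bsub>C00\<^esub> d01 l0 = \<zero>\<^bsub>C00\<^esub> \<longrightarrow>
            (\<zero>\<^bsub>C21\<^esub>, l1, l0) \<in> cycles1 C \<and>
            \<Phi> (hclass1 Cg (hclass1 K1 l1)) = hclass1 C (\<zero>\<^bsub>C21\<^esub>, l1, l0))))"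
proof -
  interpret T: triangular_complex F2 C22 C12 C02 C21 C11 C01 C20 C10 C00 C
      d22 d12 d02 g22 g12 p2 d21 d11 d01 g21 g11 p1
    by (rule triangular_complex.intro) fact+
  have K: "K2 = T.K2" "K1 = T.K1" "K0 = T.K0"
    by (simp_all add: K2 K1 K0 T.K2_def T.K1_def T.K0_def)
  have Cg': "Cg = T.induced.Cg"
    by (simp add: Cg K T.induced.Cg_def)
  \<comment> \<open>The class of \<open>l1\<close> is a cycle of \<open>Cg\<close>, so
    \<open>g11 l1\<close> is a boundary of \<open>K0\<close>, which is the existence of
    \<open>l0\<close> in disguise.\<close>
  have lift: "\<exists>l0\<in>carrier C01. g11 l1 \<oplus>\<^bsub>C00\<^esub> d01 l0 = \<zero>\<^bsub>C00\<^esub>"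
    if l1: "l1 \<in> cycles1 T.K1" "hclass1 T.K1 l1 \<in> cycles1 T.induced.Cg" for l1
  proof -
    have "g11 l1 \<in> carrier C00" using l1(1) by (simp add: T.mem_cycles)
    then show ?thesis
      using l1 by (simp add: T.induced.hclass1_mem_cycles1_Cg_iff T.mem_boundaries0_K0)
  qed
  have iso: "\<exists>\<Phi>\<in>module_iso F2 (homology1 T.induced.Cg) (homology1 C).
      \<forall>l1\<in>cycles1 T.K1. hclass1 T.K1 l1 \<in> cycles1 T.induced.Cg \<longrightarrow>
        (\<forall>l0\<in>carrier C01. g11 l1 \<oplus>\<^bsub>C00\<^esub> d01 l0 = \<zero>\<^bsub>C00\<^esub> \<longrightarrow>
          (\<zero>\<^bsub>C21\<^esub>, l1, l0) \<in> cycles1 C \<and>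
          \<Phi> (hclass1 T.induced.Cg (hclass1 T.K1 l1)) = hclass1 C (\<zero>\<^bsub>C21\<^esub>, l1, l0))"
    if acyclic: "carrier (homology1 T.K0) = {\<zero>\<^bsub>homology1 T.K0\<^esub>}"
      "carrier (homology1 T.K2) = {\<zero>\<^bsub>homology1 T.K2\<^esub>}"
  proof -
    obtain \<Phi> where \<Phi>: "\<Phi> \<in> module_iso F2 (homology1 T.induced.Cg) (homology1 C)"
        "\<And>c. c \<in> T.reduced_cycles \<Longrightarrow>
          \<Phi> (hclass1 T.induced.Cg (hclass1 T.K1 (fst (snd c)))) = hclass1 C c"
      using T.homology1_iso[OF acyclic] by blast
    have "(\<zero>\<^bsub>C21\<^esub>, l1, l0) \<in> cycles1 C \<and>
        \<Phi> (hclass1 T.induced.Cg (hclass1 T.K1 l1)) = hclass1 C (\<zero>\<^bsub>C21\<^esub>, l1, l0)"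
      if "l1 \<in> cycles1 T.K1" "l0 \<in> carrier C01" "g11 l1 \<oplus>\<^bsub>C00\<^esub> d01 l0 = \<zero>\<^bsub>C00\<^esub>" for l1 l0
    proof -
      \<comment> \<open>Every admissible \<open>l0\<close> gives a reduced cycle with middle
        component \<open>l1\<close>, so the formula for \<open>\<Phi>\<close> holds for each
        choice.\<close>
      have "(\<zero>\<^bsub>C21\<^esub>, l1, l0) \<in> T.reduced_cycles"
        using that by (simp add: T.mem_reduced_cycles)
      then show ?thesis using \<Phi>(2)[of "(\<zero>\<^bsub>C21\<^esub>, l1, l0)"] by (simp add: T.reduced_cycles_def)
    qed
    with \<Phi>(1) show ?thesis by blast
  qed
  have g2: "\<forall>l\<in>cycles2 T.K2. g22 l \<in> cycles1 T.K1 \<and>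
      bd2 T.induced.Cg (hclass2 T.K2 l) = hclass1 T.K1 (g22 l)"
    using T.induced.g2_cycles T.induced.bd2_Cg by blast
  have g1: "\<forall>l\<in>cycles1 T.K1. g11 l \<in> cycles0 T.K0 \<and>
      bd1 T.induced.Cg (hclass1 T.K1 l) = hclass0 T.K0 (g11 l)"
    using T.induced.g1_cycles T.induced.bd1_Cg by blast
  have lifts: "\<forall>l1\<in>cycles1 T.K1. hclass1 T.K1 l1 \<in> cycles1 T.induced.Cg \<longrightarrow>
      (\<exists>l0\<in>carrier C01. g11 l1 \<oplus>\<^bsub>C00\<^esub> d01 l0 = \<zero>\<^bsub>C00\<^esub>)"
    using lift by blast
  show ?thesis
    unfolding K Cg'
    by (intro conjI impI)
      (rule T.chain_complex3_K g2 g1 T.induced.chain_complex3_Cg lifts iso | elim conjE, assumption)+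
qed

end
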